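(* Let $\mathbb{F}$ be a finite field of order $q$, $\theta$ a non-trivial additive character of $\mathbb{F}$, and $t$ a variable. For integers $0\le n\le m$ let $\varPhi_{n,m}$ be the canonical matrix of the pair $(\operatorname{Mat}_{n,m}(\mathbb{F}),\operatorname{GL}_n(\mathbb{F})\times\operatorname{GL}_m(\mathbb{F}))$. Then $$\sum_{r=0}^n\varPhi_{n,m}(s,r)\,t^r=(t;q)_s\cdot\sum_{u=0}^{n-s}(-1)^uq^{\binom u2+su}(q^{m-s};q^{-1})_u\begin{bmatrix} n-s \\ u \end{bmatrix}_q t^u\qquad(0\le s\le n\le m).$$
   Context: $\operatorname{Mat}_{n,m}(\mathbb{F})$ is the additive group of $n\times m$ matrices, with $\operatorname{GL}_n(\mathbb{F})\times\operatorname{GL}_m(\mathbb{F})$ acting by $(g,h)\cdot a=ga\,{}^th$, and $\langle a|b\rangle=\operatorname{trace}({}^tab)$. The canonical matrix is $$\varPhi_{n,m}(s,r)=\sum_{b\in\operatorname{Mat}_{n,m}(\mathbb{F}),\ \operatorname{rank}b=r}\overline{\theta(\langle a|b\rangle)},\qquad a\text{ any matrix with }\operatorname{rank}a=s$$ (independent of the choice of $a$). Notation: $(a;q)_k=(1-a)(1-aq)\cdots(1-aq^{k-1})$, $(a;q)_0=1$; $\begin{bmatrix} N \\ x \end{bmatrix}_q=\dfrac{(q^N;q^{-1})_x}{(q;q)_x}$. *)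

theory Defs
  imports
    Complex_Main
    "HOL-Computational_Algebra.Polynomial"
    "Jordan_Normal_Form.DL_Rank"
begin

(* A homomorphism from the additive group of the field to the multiplicative group of \<complex>. *)
definition additive_character :: "('a::field \<Rightarrow> complex) \<Rightarrow> bool" where
  "additive_character \<theta> \<longleftrightarrow> (\<forall>x. \<theta> x \<noteq> 0) \<and> (\<forall>x y. \<theta> (x + y) = \<theta> x * \<theta> y)"

definition nontrivial_additive_character :: "('a::field \<Rightarrow> complex) \<Rightarrow> bool" where
  "nontrivial_additive_character \<theta> \<longleftrightarrow> additive_character \<theta> \<and> (\<exists>x. \<theta> x \<noteq> 1)"

definition mat_trace :: "'a::comm_monoid_add mat \<Rightarrow> 'a" where
  "mat_trace A = (\<Sum>i<dim_row A. A $$ (i, i))"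

definition mat_pairing :: "'a::comm_ring_1 mat \<Rightarrow> 'a mat \<Rightarrow> 'a" where
  "mat_pairing a b = mat_trace (transpose_mat a * b)"

(* The first argument of vec_space.rank is the number of rows. *)
definition rank_character_sum ::
    "('a::{field,finite} \<Rightarrow> complex) \<Rightarrow> nat \<Rightarrow> nat \<Rightarrow> 'a mat \<Rightarrow> nat \<Rightarrow> complex" where
  "rank_character_sum \<theta> n m a r =
     (\<Sum>b | b \<in> carrier_mat n m \<and> vec_space.rank n b = r. cnj (\<theta> (mat_pairing a b)))"

(* The entry (s, r) is the common value of the character sum at all matrices a of rank s;
   the description is only meaningful because the sum does not depend on the choice of a. *)
definition canonical_matrix ::
    "('a::{field,finite} \<Rightarrow> complex) \<Rightarrow> nat \<Rightarrow> nat \<Rightarrow> nat \<Rightarrow> nat \<Rightarrow> complex" where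
  "canonical_matrix \<theta> n m s r =
     (THE c. \<forall>a \<in> carrier_mat n m. vec_space.rank n a = s \<longrightarrow> rank_character_sum \<theta> n m a r = c)"

(* (a;q)_k; the base q is an arbitrary ring element, so that it may be an inverse
   or a constant polynomial. *)
definition q_pochhammer :: "'a::comm_ring_1 \<Rightarrow> 'a \<Rightarrow> nat \<Rightarrow> 'a" where
  "q_pochhammer a q k = (\<Prod>i<k. 1 - a * q ^ i)"

definition q_binomial :: "'a::field \<Rightarrow> nat \<Rightarrow> nat \<Rightarrow> 'a" where
  "q_binomial q N x = q_pochhammer (q ^ N) (inverse q) x / q_pochhammer q q x"

end

theory Submission
  imports Defs "HOL-Library.Cardinality"
begin

text \<open>
  Fix a matrix \<open>a\<close> with columns \<open>x\<^sub>1, \<dots>, x\<^sub>m\<close> and let the columns of \<open>b\<close> range over a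
  subspace \<open>W\<close>. Summing over the first column of \<open>b\<close> alone, the character sums over \<open>W\<close> and
  over the span of the remaining columns vanish unless \<open>x\<^sub>1\<close> is orthogonal to the respective
  space, which leaves
  \<open>F\<^sub>W(x\<^sub>1, \<dots>, x\<^sub>m; t) = (1 - t) F\<^sub>W'(x\<^sub>2, \<dots>, x\<^sub>m; q t) + [x\<^sub>1 \<bottom> W] t |W| F\<^sub>W(x\<^sub>2, \<dots>, x\<^sub>m; t)\<close>,
  where \<open>W'\<close> is the part of \<open>W\<close> orthogonal to \<open>x\<^sub>1\<close>. The right-hand side of the theorem obeys
  the same recursion, with \<open>s\<close> generalised to the codimension in \<open>W\<close> of the part orthogonal to all
  \<open>x\<^sub>j\<close>. All dimensions are read off from cardinalities, which are powers of \<open>q\<close>.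
\<close>

section \<open>Finite fields, vectors and additive characters\<close>

lemma card_field_gt_1: "1 < CARD('a::{field,finite})"
proof -
  have "card {0, 1::'a} \<le> CARD('a)" by (rule card_mono) auto
  moreover have "card {0, 1::'a} = 2" by simp
  ultimately show ?thesis by linarith
qed

lemma card_carrier_vec: "card (carrier_vec n :: 'a::finite vec set) = CARD('a) ^ n"
proof -
  let ?L = "{xs :: 'a list. set xs \<subseteq> UNIV \<and> length xs = n}"
  have "bij_betw list_of_vec (carrier_vec n :: 'a vec set) ?L"
  proof (rule bij_betw_byWitness[of _ vec_of_list])
    show "vec_of_list ` ?L \<subseteq> carrier_vec n" by (auto intro: carrier_vecI)
  qed (simp_all add: vec_list list_vec image_subset_iff)
  then have "card (carrier_vec n :: 'a vec set) = card ?L" by (rule bij_betw_same_card)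
  then show ?thesis using card_lists_length_eq[of "UNIV :: 'a set" n] by simp
qed

lemma finite_carrier_vec [simp]: "finite (carrier_vec n :: 'a::finite vec set)"
  by (rule card_ge_0_finite) (simp only: card_carrier_vec zero_less_power zero_less_card_finite)

text \<open>Absorbs the conjugation in \<open>rank_character_sum\<close> once and for all:
  everything below is done for a character \<chi>, later taken to be the conjugate of
  \<theta>.\<close>

lemma nontrivial_additive_character_cnj:
  assumes "nontrivial_additive_character \<theta>"
  shows "nontrivial_additive_character (\<lambda>x. cnj (\<theta> x))"
proof -
  obtain x where "\<theta> x \<noteq> 1" using assms by (auto simp: nontrivial_additive_character_def)
  then have "cnj (\<theta> x) \<noteq> 1" by (metis complex_cnj_cnj complex_cnj_one)
  then show ?thesis
    using assms by (auto simp: nontrivial_additive_character_def additive_character_def)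
qed

lemma additive_character_add: "additive_character \<chi> \<Longrightarrow> \<chi> (x + y) = \<chi> x * \<chi> y"
  by (simp add: additive_character_def)

lemma additive_character_0: "additive_character \<chi> \<Longrightarrow> \<chi> 0 = 1"
  using additive_character_add[of \<chi> 0 0] by (auto simp: additive_character_def)

text \<open>The sum over the head is innermost, so that the first column can be summed while the
  remaining columns stay fixed.\<close>

lemma sum_lists_length_Suc:
  fixes f :: "'a list \<Rightarrow> 'b::comm_monoid_add"
  assumes "finite A"
  shows "(\<Sum>ys | set ys \<subseteq> A \<and> length ys = Suc k. f ys) =
    (\<Sum>ys | set ys \<subseteq> A \<and> length ys = k. \<Sum>v\<in>A. f (v # ys))"
proof -
  let ?L = "{ys. set ys \<subseteq> A \<and> length ys = k}"
  have "{ys. set ys \<subseteq> A \<and> length ys = Suc k} = (\<lambda>(ys, v). v # ys) ` (?L \<times> A)"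
    by (auto simp: length_Suc_conv image_iff)
  moreover have "inj_on (\<lambda>(ys, v). v # ys) (?L \<times> A)" by (auto simp: inj_on_def)
  ultimately show ?thesis
    by (simp add: sum.reindex sum.cartesian_product o_def case_prod_unfold)
qed

section \<open>The q-series of the right-hand side and its recursion\<close>

text \<open>The second factor of the theorem is \<open>q_sum q (n - s) (m - s) (q ^ s * t)\<close>.
  The parameters \<open>e\<close> and \<open>k\<close> are independent because the recursion moves
  \<open>k\<close> alone.\<close>

definition q_sum :: "complex \<Rightarrow> nat \<Rightarrow> nat \<Rightarrow> complex \<Rightarrow> complex" where
  "q_sum q e k t = (\<Sum>u\<le>e. (-1) ^ u * q ^ (u choose 2) * q_pochhammer (q ^ k) (inverse q) u *
     q_binomial q e u * t ^ u)"

lemma q_pochhammer_0 [simp]: "q_pochhammer a q 0 = 1"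
  by (simp add: q_pochhammer_def)

lemma q_pochhammer_Suc: "q_pochhammer a q (Suc k) = q_pochhammer a q k * (1 - a * q ^ k)"
  by (simp add: q_pochhammer_def)

lemma q_pochhammer_Suc_left: "q_pochhammer a q (Suc k) = (1 - a) * q_pochhammer (a * q) q k"
  unfolding q_pochhammer_def prod.lessThan_Suc_shift by (simp add: mult.assoc)

lemma q_binomial_Suc_mult:
  assumes "q \<noteq> 0" "q ^ Suc u \<noteq> 1"
  shows "q_binomial q e (Suc u) * (1 - q ^ Suc u) * q ^ u = q_binomial q e u * (q ^ u - q ^ e)"
proof -
  have "q_binomial q e (Suc u) * (1 - q ^ Suc u) = q_binomial q e u * (1 - q ^ e * inverse q ^ u)"
    using assms(2) by (simp add: q_binomial_def q_pochhammer_Suc)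
  moreover have "(1 - q ^ e * inverse q ^ u) * q ^ u = q ^ u - q ^ e"
    using assms(1) by (simp add: power_inverse left_diff_distrib)
  ultimately show ?thesis by (metis mult.assoc)
qed

text \<open>The last factor of the numerator is \<open>1 - q ^ e * inverse q ^ e\<close>.\<close>

lemma q_binomial_eq_0:
  assumes "q \<noteq> 0"
  shows "q_binomial q e (Suc e) = 0"
  using assms by (simp add: q_binomial_def q_pochhammer_Suc power_inverse)

lemma q_sum_0: "q_sum q e 0 t = 1"
proof -
  have "q_pochhammer 1 (inverse q) u = 0" if "u \<noteq> 0" for u
    using that by (cases u) (auto simp: q_pochhammer_Suc_left)
  then have "q_sum q e 0 t = (\<Sum>u\<le>e. if u = 0 then 1 else 0)"
    unfolding q_sum_def by (intro sum.cong) (auto simp: q_binomial_def binomial_eq_0)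
  then show ?thesis by simp
qed

text \<open>Comparison of the coefficients of \<open>t ^ Suc u\<close>. For
  \<open>q ^ e = |W|\<close> this is the recursion of \<open>rank_sum\<close> for a first column
  orthogonal to \<open>W\<close>.\<close>

lemma q_sum_Suc:
  assumes q: "q \<noteq> 0" "\<And>u. q ^ Suc u \<noteq> 1"
  shows "q_sum q e (Suc k) t = (1 - t) * q_sum q e k (q * t) + t * q ^ e * q_sum q e k t"
proof -
  define g where "g k u = (-1) ^ u * q ^ (u choose 2) * q_pochhammer (q ^ k) (inverse q) u *
     q_binomial q e u" for k u
  have G: "q_sum q e k t = (\<Sum>u\<le>e. g k u * t ^ u)" for k t by (simp add: q_sum_def g_def)
  have g0: "g k 0 = 1" for k by (simp add: g_def q_binomial_def binomial_eq_0)
  have ge: "g k (Suc e) = 0" for k using q q_binomial_eq_0[of q e] by (simp add: g_def)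
  have rec: "g (Suc k) (Suc u) = q ^ Suc u * g k (Suc u) + (q ^ e - q ^ u) * g k u" for u
  proof -
    let ?P = "q_pochhammer (q ^ k) (inverse q) u"
    let ?B = "q_binomial q e (Suc u)"
    have c: "Suc u choose 2 = (u choose 2) + u" by (simp add: numeral_2_eq_2)
    \<comment> \<open>One factor is split off in front for \<open>Suc k\<close> and at the end for
      \<open>k\<close>, so that both products share \<open>?P\<close>.\<close>
    have "q ^ Suc k * inverse q = q ^ k" using q(1) by simp
    then have e1: "q_pochhammer (q ^ Suc k) (inverse q) (Suc u) = (1 - q ^ Suc k) * ?P"
      unfolding q_pochhammer_Suc_left by metis
    have e2: "q ^ Suc u * q_pochhammer (q ^ k) (inverse q) (Suc u) = (q ^ Suc u - q ^ Suc k) * ?P"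
      using q by (simp add: q_pochhammer_Suc power_inverse field_simps)
    have P: "q_pochhammer (q ^ Suc k) (inverse q) (Suc u) =
        q ^ Suc u * q_pochhammer (q ^ k) (inverse q) (Suc u) + (1 - q ^ Suc u) * ?P"
      unfolding e1 e2 by (simp add: left_diff_distrib)
    have "(q ^ e - q ^ u) * g k u = (-1) ^ u * q ^ (u choose 2) * ?P * - (q_binomial q e u * (q ^ u - q ^ e))"
      by (simp add: g_def algebra_simps)
    also have "\<dots> = (-1) ^ Suc u * q ^ (Suc u choose 2) * ((1 - q ^ Suc u) * ?P) * ?B"
      unfolding q_binomial_Suc_mult[OF q, symmetric] c by (simp add: power_add)
    finally show ?thesis unfolding g_def P by (simp add: algebra_simps)
  qed
  \<comment> \<open>The right-hand sum may run up to \<open>e\<close> again because its top term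
    contains \<open>g k (Suc e) = 0\<close>.\<close>
  have shift: "(\<Sum>u\<le>e. g k u * y ^ u) = 1 + (\<Sum>u\<le>e. g k (Suc u) * y ^ Suc u)" for k y
  proof -
    have "(\<Sum>u\<le>e. g k u * y ^ u) = (\<Sum>u\<le>Suc e. g k u * y ^ u)" by (simp add: ge)
    also have "\<dots> = 1 + (\<Sum>u\<le>e. g k (Suc u) * y ^ Suc u)"
      unfolding sum.atMost_Suc_shift by (simp add: g0)
    finally show ?thesis .
  qed
  have "q_sum q e (Suc k) t = 1 + (\<Sum>u\<le>e. (q ^ Suc u * g k (Suc u) + (q ^ e - q ^ u) * g k u) * t ^ Suc u)"
    unfolding G shift rec ..
  also have "\<dots> = 1 + (\<Sum>u\<le>e. g k (Suc u) * (q * t) ^ Suc u) +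
      (\<Sum>u\<le>e. t * q ^ e * (g k u * t ^ u) - t * (g k u * (q * t) ^ u))"
    by (simp add: sum.distrib[symmetric] algebra_simps power_mult_distrib)
  also have "\<dots> = (\<Sum>u\<le>e. g k u * (q * t) ^ u) +
      (\<Sum>u\<le>e. t * q ^ e * (g k u * t ^ u) - t * (g k u * (q * t) ^ u))"
    unfolding shift[of k "q * t"] ..
  also have "\<dots> = (1 - t) * q_sum q e k (q * t) + t * q ^ e * q_sum q e k t"
    unfolding G by (simp add: sum_subtractf sum_distrib_left[symmetric] algebra_simps)
  finally show ?thesis .
qed

section \<open>Matrices as lists of columns\<close>

lemma mat_pairing_mat_of_cols:
  assumes "set xs \<subseteq> carrier_vec n" "set ys \<subseteq> carrier_vec n" "length ys = length xs"
  shows "mat_pairing (mat_of_cols n xs) (mat_of_cols n ys) = sum_list (map2 (\<bullet>) xs ys)"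
proof -
  have "sum_list (map2 (\<bullet>) xs ys) = (\<Sum>i<length xs. xs ! i \<bullet> ys ! i)"
    using assms(3) by (simp add: sum_list_sum_nth atLeast0LessThan)
  moreover have "xs ! i \<in> carrier_vec n" "ys ! i \<in> carrier_vec n" if "i < length xs" for i
    using that assms nth_mem[of i xs] nth_mem[of i ys] by (simp_all add: subset_iff)
  ultimately show ?thesis
    using assms(3) unfolding mat_pairing_def mat_trace_def by simp
qed

lemma bij_betw_mat_of_cols:
  "bij_betw (mat_of_cols n) {ys. set ys \<subseteq> carrier_vec n \<and> length ys = m} (carrier_mat n m :: 'a mat set)"
proof (rule bij_betw_byWitness[of _ cols])
  show "cols ` (carrier_mat n m :: 'a mat set) \<subseteq> {ys. set ys \<subseteq> carrier_vec n \<and> length ys = m}"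
  proof (rule image_subsetI)
    fix B :: "'a mat" assume "B \<in> carrier_mat n m"
    then show "cols B \<in> {ys. set ys \<subseteq> carrier_vec n \<and> length ys = m}"
      using cols_dim[of B] by simp
  qed
  show "\<forall>B\<in>carrier_mat n m :: 'a mat set. mat_of_cols n (cols B) = B"
    using mat_of_cols_cols by blast
  show "mat_of_cols n ` {ys :: 'a vec list. set ys \<subseteq> carrier_vec n \<and> length ys = m} \<subseteq> carrier_mat n m"
    using mat_of_cols_carrier(1)[of n] by blast
qed (use cols_mat_of_cols in blast)

lemma poly_q_pochhammer: "poly (q_pochhammer a b k) x = q_pochhammer (poly a x) (poly b x) k"
  by (simp add: q_pochhammer_def poly_prod)

section \<open>Subspaces, spans and ranks through cardinalities\<close>

locale finite_vec_space = vec_space f_ty n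
  for f_ty :: "'a::{field,finite} itself" and n
begin

lemma submodule_vec_iff:
  "submodule class_ring W V \<longleftrightarrow> W \<subseteq> carrier_vec n \<and> 0\<^sub>v n \<in> W \<and>
     (\<forall>u\<in>W. \<forall>v\<in>W. u + v \<in> W) \<and> (\<forall>c. \<forall>v\<in>W. c \<cdot>\<^sub>v v \<in> W)"
  unfolding submodule_def module_vec_simps class_ring_simps
  by (simp only: module_axioms UNIV_I simp_thms Ball_def)
    (intro iffI conjI allI impI; elim conjE; blast)

lemma submodule_vecD:
  assumes "submodule class_ring W V"
  shows "W \<subseteq> carrier_vec n" "0\<^sub>v n \<in> W" "u \<in> W \<Longrightarrow> v \<in> W \<Longrightarrow> u + v \<in> W"
    "v \<in> W \<Longrightarrow> c \<cdot>\<^sub>v v \<in> W" "finite W"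
proof -
  show W: "W \<subseteq> carrier_vec n" using assms unfolding submodule_vec_iff by blast
  show "finite W" by (rule finite_subset[OF W finite_carrier_vec])
qed (use assms[unfolded submodule_vec_iff] in simp_all)

lemma submodule_add_line:
  assumes W: "submodule class_ring W V" and v: "v \<in> carrier_vec n"
  shows "submodule class_ring {c \<cdot>\<^sub>v v + w | c w. w \<in> W} V"
  unfolding submodule_vec_iff
proof (intro conjI ballI allI)
  note * = submodule_vecD[OF W]
  show "{c \<cdot>\<^sub>v v + w | c w. w \<in> W} \<subseteq> carrier_vec n" using * v by auto
  show "0\<^sub>v n \<in> {c \<cdot>\<^sub>v v + w | c w. w \<in> W}"
    using * v by (auto intro!: exI[of _ 0] exI[of _ "0\<^sub>v n"])
  fix x assume "x \<in> {c \<cdot>\<^sub>v v + w | c w. w \<in> W}"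
  then obtain c w where x: "x = c \<cdot>\<^sub>v v + w" "w \<in> W" by auto
  have w: "w \<in> carrier_vec n" using x * by auto
  show "d \<cdot>\<^sub>v x \<in> {c \<cdot>\<^sub>v v + w | c w. w \<in> W}" for d
    using x w v * by (auto intro!: exI[of _ "d * c"] exI[of _ "d \<cdot>\<^sub>v w"] simp: smult_add_distrib_vec smult_smult_assoc)
  fix y assume "y \<in> {c \<cdot>\<^sub>v v + w | c w. w \<in> W}"
  then obtain d z where y: "y = d \<cdot>\<^sub>v v + z" "z \<in> W" by auto
  have z: "z \<in> carrier_vec n" using y * by auto
  have "x + y = (c + d) \<cdot>\<^sub>v v + (w + z)"
    unfolding x y by (rule eq_vecI) (use w z v in \<open>auto simp: algebra_simps\<close>)
  moreover have "w + z \<in> W" using x y * by auto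
  ultimately show "x + y \<in> {c \<cdot>\<^sub>v v + w | c w. w \<in> W}" by blast
qed

lemma span_insert_vec:
  assumes S: "S \<subseteq> carrier_vec n" and v: "v \<in> carrier_vec n"
  shows "span (insert v S) = {c \<cdot>\<^sub>v v + w | c w. w \<in> span S}" (is "_ = ?R")
proof
  have sub: "submodule class_ring (span S) V" "submodule class_ring (span (insert v S)) V"
    using S v by (auto intro!: span_is_submodule)
  show "span (insert v S) \<subseteq> ?R"
  proof (rule span_is_subset)
    show "submodule class_ring ?R V" by (rule submodule_add_line[OF sub(1) v])
    have "v \<in> ?R" using v submodule_vecD(2)[OF sub(1)]
      by (auto intro!: exI[of _ 1] exI[of _ "0\<^sub>v n"])
    moreover have "x \<in> ?R" if "x \<in> S" for x
    proof -
      have "x \<in> span S" "x \<in> carrier_vec n" using that S in_own_span[of S] by auto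
      then show ?thesis using v by (auto intro!: exI[of _ 0] exI[of _ x])
    qed
    ultimately show "insert v S \<subseteq> ?R" by blast
  qed
  have mono: "span S \<subseteq> span (insert v S)" by (rule span_is_monotone) auto
  have mem: "v \<in> span (insert v S)" using in_own_span[of "insert v S"] S v by auto
  have "c \<cdot>\<^sub>v v + w \<in> span (insert v S)" if "w \<in> span S" for c w
    using submodule_vecD(3)[OF sub(2) submodule_vecD(4)[OF sub(2) mem] subsetD[OF mono that]] .
  then show "?R \<subseteq> span (insert v S)" by auto
qed

lemma card_add_line:
  assumes W: "submodule class_ring W V" and v: "v \<in> carrier_vec n" "v \<notin> W"
  shows "card {c \<cdot>\<^sub>v v + w | c w. w \<in> W} = CARD('a) * card W"
proof -
  note * = submodule_vecD[OF W]
  have "inj_on (\<lambda>(c, w). c \<cdot>\<^sub>v v + w) (UNIV \<times> W)"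
  proof (clarsimp simp: inj_on_def)
    fix c w d z assume A: "w \<in> W" "z \<in> W" "c \<cdot>\<^sub>v v + w = d \<cdot>\<^sub>v v + z"
    then have car: "w \<in> carrier_vec n" "z \<in> carrier_vec n" using * by auto
    have eq: "c * v $ i + w $ i = d * v $ i + z $ i" if "i < n" for i
      using arg_cong[OF A(3), of "\<lambda>x. x $ i"] that car v by simp
    have "c = d"
    proof (rule ccontr)
      assume "c \<noteq> d"
      \<comment> \<open>Two representations with different multiples of \<open>v\<close> could be
        solved for \<open>v\<close>, placing it in \<open>W\<close>.\<close>
      have "v = inverse (c - d) \<cdot>\<^sub>v (z + (-1) \<cdot>\<^sub>v w)"
      proof (rule eq_vecI)
        fix i assume "i < dim_vec (inverse (c - d) \<cdot>\<^sub>v (z + (-1) \<cdot>\<^sub>v w))"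
        then have i: "i < n" using car by auto
        show "v $ i = (inverse (c - d) \<cdot>\<^sub>v (z + (-1) \<cdot>\<^sub>v w)) $ i"
          using eq[OF i] i car \<open>c \<noteq> d\<close> by (simp add: field_simps)
      qed (use car v in auto)
      then show False using v A * by metis
    qed
    moreover have "w = z"
      by (rule eq_vecI) (use eq \<open>c = d\<close> car in auto)
    ultimately show "c = d \<and> w = z" by simp
  qed
  moreover have "{c \<cdot>\<^sub>v v + w | c w. w \<in> W} = (\<lambda>(c, w). c \<cdot>\<^sub>v v + w) ` (UNIV \<times> W)" by auto
  ultimately show ?thesis by (simp add: card_image card_cartesian_product)
qed

lemma card_span_lin_indpt:
  assumes "finite S" "S \<subseteq> carrier_vec n" "lin_indpt S"
  shows "card (span S) = CARD('a) ^ card S"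
  using assms
proof (induction S rule: finite_induct)
  case empty
  then show ?case by (simp add: span_empty)
next
  case (insert v S)
  have S: "S \<subseteq> carrier_vec n" "v \<in> carrier_vec n" using insert.prems by auto
  have "lin_indpt S" using insert.prems supset_ld_is_ld by blast
  moreover have "v \<notin> span S"
    using lin_dep_iff_in_span[of S v] insert S calculation by auto
  ultimately show ?case
    using insert S card_add_line[OF span_is_submodule[of S] S(2)] by (simp add: span_insert_vec)
qed

text \<open>A maximal independent subset of the columns has the same span, and its size is the rank.
  This allows ranks to be compared as exponents of \<open>CARD('a)\<close>.\<close>

lemma card_span_eq_rank:
  assumes "set us \<subseteq> carrier_vec n"
  shows "card (span (set us)) = CARD('a) ^ rank (mat_of_cols n us)"
proof -
  have "lin_indpt {}" unfolding lin_dep_def by (intro notI, elim exE conjE, simp)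
  then obtain S where S: "maximal S (\<lambda>T. T \<subseteq> set us \<and> lin_indpt T)" "finite S"
    using maximal_exists_superset[of "set us" "\<lambda>T. T \<subseteq> set us \<and> lin_indpt T" "{}"]
    by blast
  then have S': "S \<subseteq> set us" "lin_indpt S" "S \<subseteq> carrier_vec n"
    using assms by (auto simp: maximal_def)
  have "v \<in> span S" if "v \<in> set us" for v
  proof (rule ccontr)
    assume v: "v \<notin> span S"
    then have "v \<notin> S" using in_own_span[of S] S' by auto
    moreover have "lin_indpt (S \<union> {v})"
      using lin_dep_iff_in_span[of S v] v S' that assms \<open>v \<notin> S\<close> by auto
    ultimately show False using S(1) that S' unfolding maximal_def by blast
  qed
  then have "span (set us) \<subseteq> span S" using S' by (intro span_subsetI) auto
  moreover have "span S \<subseteq> span (set us)" using S' by (intro span_is_monotone)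
  ultimately have "span (set us) = span S" by simp
  moreover have "rank (mat_of_cols n us) = card S"
    using rank_card_indpt[of "mat_of_cols n us" "length us" S] S assms by simp
  ultimately show ?thesis using card_span_lin_indpt[of S] S S' by simp
qed

text \<open>The span of the columns either stays the same or grows by the factor
  \<open>CARD('a)\<close>; the rank is the exponent.\<close>

lemma rank_mat_of_cols_Cons:
  assumes "set us \<subseteq> carrier_vec n" "v \<in> carrier_vec n"
  shows "rank (mat_of_cols n (v # us)) =
    (if v \<in> span (set us) then rank (mat_of_cols n us) else Suc (rank (mat_of_cols n us)))"
proof -
  let ?r = "rank (mat_of_cols n us)"
  have sub: "submodule class_ring (span (set us)) V" by (rule span_is_submodule[OF assms(1)])
  have c: "card (span (set us)) = CARD('a) ^ ?r" by (rule card_span_eq_rank[OF assms(1)])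
  have "set (v # us) \<subseteq> carrier_vec n" using assms by simp
  from card_span_eq_rank[OF this]
  have c': "CARD('a) ^ rank (mat_of_cols n (v # us)) = card (span (insert v (set us)))"
    by (simp only: list.set)
  show ?thesis
  proof (cases "v \<in> span (set us)")
    case True
    have "insert v (set us) \<subseteq> span (set us)" using True in_own_span[OF assms(1)] by blast
    then have "span (insert v (set us)) = span (set us)"
      using span_subsetI[OF assms(1)] span_is_monotone[of "set us" "insert v (set us)"] by blast
    then have "CARD('a) ^ rank (mat_of_cols n (v # us)) = CARD('a) ^ ?r" using c c' by metis
    then have "rank (mat_of_cols n (v # us)) = ?r" by (rule power_inject_exp[THEN iffD1, OF card_field_gt_1])
    then show ?thesis using True by metis
  next
    case False
    have "CARD('a) ^ rank (mat_of_cols n (v # us)) = CARD('a) ^ Suc ?r"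
      unfolding c' span_insert_vec[OF assms] card_add_line[OF sub assms(2) False] c power_Suc ..
    then have "rank (mat_of_cols n (v # us)) = Suc ?r" by (rule power_inject_exp[THEN iffD1, OF card_field_gt_1])
    then show ?thesis using False by metis
  qed
qed

section \<open>Orthogonality conditions on a subspace\<close>

lemma submodule_inter_perp:
  assumes W: "submodule class_ring W V" and "A \<subseteq> carrier_vec n"
  shows "submodule class_ring {v \<in> W. \<forall>a\<in>A. a \<bullet> v = 0} V"
  unfolding submodule_vec_iff
proof (intro conjI ballI allI)
  note * = submodule_vecD[OF W]
  show "{v \<in> W. \<forall>a\<in>A. a \<bullet> v = 0} \<subseteq> carrier_vec n" using *(1) by blast
  show "0\<^sub>v n \<in> {v \<in> W. \<forall>a\<in>A. a \<bullet> v = 0}" using *(2) assms(2) by auto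
  fix u assume u: "u \<in> {v \<in> W. \<forall>a\<in>A. a \<bullet> v = 0}"
  then have uc: "u \<in> carrier_vec n" using *(1) by blast
  show "c \<cdot>\<^sub>v u \<in> {v \<in> W. \<forall>a\<in>A. a \<bullet> v = 0}" for c
  proof -
    have "a \<bullet> (c \<cdot>\<^sub>v u) = 0" if "a \<in> A" for a
      using that u uc assms(2) by (simp add: subset_iff)
    then show ?thesis using u *(4) by blast
  qed
  fix v assume v: "v \<in> {v \<in> W. \<forall>a\<in>A. a \<bullet> v = 0}"
  then have vc: "v \<in> carrier_vec n" using *(1) by blast
  have "a \<bullet> (u + v) = 0" if "a \<in> A" for a
  proof -
    have "a \<in> carrier_vec n" using that assms(2) by blast
    then show ?thesis using scalar_prod_add_distrib[OF _ uc vc, of a] that u v by simp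
  qed
  then show "u + v \<in> {v \<in> W. \<forall>a\<in>A. a \<bullet> v = 0}" using u v *(3) by blast
qed

text \<open>\<open>W\<close> is the hyperplane plus the line through \<open>v\<close>: subtracting
  the multiple \<open>(w \<bullet> x) / (w \<bullet> v)\<close> of \<open>v\<close> from
  \<open>x\<close> lands in the hyperplane.\<close>

lemma card_hyperplane:
  assumes W: "submodule class_ring W V" and w: "w \<in> carrier_vec n" and v: "v \<in> W" "w \<bullet> v \<noteq> 0"
  shows "card W = CARD('a) * card {v \<in> W. w \<bullet> v = 0}"
proof -
  note * = submodule_vecD(1-4)[OF W]
  let ?H = "{v \<in> W. w \<bullet> v = 0}"
  have H: "submodule class_ring ?H V" using submodule_inter_perp[OF W, of "{w}"] w by simp
  have vc: "v \<in> carrier_vec n" using v * by auto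
  have "W = {c \<cdot>\<^sub>v v + u | c u. u \<in> ?H}"
  proof (intro equalityI subsetI)
    fix x assume x: "x \<in> W"
    then have xc: "x \<in> carrier_vec n" using * by auto
    let ?c = "(w \<bullet> x) / (w \<bullet> v)"
    have "x = ?c \<cdot>\<^sub>v v + (x + (- ?c) \<cdot>\<^sub>v v)" using xc vc by (intro eq_vecI) auto
    moreover have "x + (- ?c) \<cdot>\<^sub>v v \<in> ?H"
      using scalar_prod_add_distrib[OF w xc, of "(- ?c) \<cdot>\<^sub>v v"] *(3)[OF x *(4)[OF v(1)]] vc w v(2) by simp
    ultimately show "x \<in> {c \<cdot>\<^sub>v v + u | c u. u \<in> ?H}" by blast
  next
    fix x assume "x \<in> {c \<cdot>\<^sub>v v + u | c u. u \<in> ?H}"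
    then show "x \<in> W" using v(1) *(3,4) by blast
  qed
  moreover have "v \<notin> ?H" using v by blast
  ultimately show ?thesis using card_add_line[OF H vc] by metis
qed

section \<open>Character sums weighted by rank\<close>

text \<open>This is \<open>F_W\<close> of the introduction. The subspace is a parameter because the
  recursion replaces it by a smaller one.\<close>

definition rank_sum :: "('a \<Rightarrow> complex) \<Rightarrow> 'a vec set \<Rightarrow> 'a vec list \<Rightarrow> complex \<Rightarrow> complex" where
  "rank_sum \<chi> W xs t = (\<Sum>ys | set ys \<subseteq> W \<and> length ys = length xs.
     \<chi> (sum_list (map2 (\<bullet>) xs ys)) * t ^ rank (mat_of_cols n ys))"

text \<open>If \<open>x\<close> is not orthogonal to \<open>W\<close>, translation by a suitable
  element of \<open>W\<close> multiplies the sum by a value of \<chi> other than 1, so the sum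
  vanishes.\<close>

lemma character_sum_submodule:
  assumes \<chi>: "nontrivial_additive_character \<chi>" and W: "submodule class_ring W V"
    and x: "x \<in> carrier_vec n"
  shows "(\<Sum>v\<in>W. \<chi> (x \<bullet> v)) = (if \<forall>v\<in>W. x \<bullet> v = 0 then of_nat (card W) else 0)"
proof (cases "\<forall>v\<in>W. x \<bullet> v = 0")
  case True
  then have "(\<Sum>v\<in>W. \<chi> (x \<bullet> v)) = (\<Sum>v\<in>W. 1)"
    using \<chi> by (intro sum.cong) (auto simp: nontrivial_additive_character_def additive_character_0)
  then show ?thesis using True by simp
next
  case False
  note * = submodule_vecD[OF W]
  obtain v where v: "v \<in> W" "x \<bullet> v \<noteq> 0" using False by auto
  obtain y where y: "\<chi> y \<noteq> 1" using \<chi> by (auto simp: nontrivial_additive_character_def)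
  \<comment> \<open>The scaling makes \<open>x \<bullet> u\<close> equal to \<open>y\<close>, where
    \<chi> is not 1.\<close>
  define u where "u = (y / (x \<bullet> v)) \<cdot>\<^sub>v v"
  have u: "u \<in> W" "u \<in> carrier_vec n" "x \<bullet> u = y" using v * x by (auto simp: u_def)
  have "bij_betw (\<lambda>v. u + v) W W"
  proof (rule bij_betw_byWitness[of _ "\<lambda>v. (-1) \<cdot>\<^sub>v u + v"])
    show "\<forall>v\<in>W. (-1) \<cdot>\<^sub>v u + (u + v) = v" "\<forall>v\<in>W. u + ((-1) \<cdot>\<^sub>v u + v) = v"
      using u * by (auto intro!: eq_vecI)
  qed (use u * in auto)
  then have "(\<Sum>v\<in>W. \<chi> (x \<bullet> v)) = (\<Sum>v\<in>W. \<chi> (x \<bullet> (u + v)))"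
    by (rule sum.reindex_bij_betw[symmetric])
  also have "\<dots> = (\<Sum>v\<in>W. \<chi> y * \<chi> (x \<bullet> v))"
    using u x * \<chi> by (intro sum.cong)
      (auto simp: scalar_prod_add_distrib[of _ n] nontrivial_additive_character_def additive_character_add)
  also have "\<dots> = \<chi> y * (\<Sum>v\<in>W. \<chi> (x \<bullet> v))" by (rule sum_distrib_left[symmetric])
  finally have "(1 - \<chi> y) * (\<Sum>v\<in>W. \<chi> (x \<bullet> v)) = 0" by (simp add: left_diff_distrib)
  then show ?thesis using y False by auto
qed

lemma span_perp_iff:
  assumes "S \<subseteq> carrier_vec n" "x \<in> carrier_vec n"
  shows "(\<forall>v\<in>span S. x \<bullet> v = 0) \<longleftrightarrow> (\<forall>v\<in>S. x \<bullet> v = 0)"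
proof
  assume "\<forall>v\<in>S. x \<bullet> v = 0"
  then have "S \<subseteq> {v \<in> carrier_vec n. \<forall>a\<in>{x}. a \<bullet> v = 0}" using assms by auto
  moreover have "submodule class_ring {v \<in> carrier_vec n. \<forall>a\<in>{x}. a \<bullet> v = 0} V"
    using assms by (intro submodule_inter_perp) (auto simp: submodule_vec_iff)
  ultimately have "span S \<subseteq> {v \<in> carrier_vec n. \<forall>a\<in>{x}. a \<bullet> v = 0}" by (rule span_is_subset)
  then show "\<forall>v\<in>span S. x \<bullet> v = 0" by auto
qed (use in_own_span[of S] assms in auto)

lemma rank_mat_of_cols_Nil: "rank (mat_of_cols n []) = 0"
proof -
  have "CARD('a) ^ rank (mat_of_cols n []) = CARD('a) ^ 0"
    using card_span_eq_rank[of "[]"] by (simp add: span_empty)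
  then show ?thesis using card_field_gt_1 by (metis power_inject_exp)
qed

lemma rank_sum_Nil [simp]:
  assumes "additive_character \<chi>"
  shows "rank_sum \<chi> W [] t = 1"
proof -
  have "{ys. set ys \<subseteq> W \<and> length ys = length []} = {[]}" by auto
  then show ?thesis using assms by (simp add: rank_sum_def additive_character_0 rank_mat_of_cols_Nil)
qed

text \<open>For fixed remaining columns \<open>ys\<close> of rank \<open>r\<close>, the character
  sum over \<open>span (set ys)\<close> contributes its cardinality \<open>q ^ r\<close>, which
  turns \<open>t ^ r\<close> into \<open>(q * t) ^ r\<close>; the sum over \<open>W\<close>
  contributes \<open>card W\<close>.\<close>

lemma rank_sum_Cons:
  assumes \<chi>: "nontrivial_additive_character \<chi>" and W: "submodule class_ring W V"
    and x: "x \<in> carrier_vec n"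
  shows "rank_sum \<chi> W (x # xs) t =
    (1 - t) * rank_sum \<chi> {v \<in> W. x \<bullet> v = 0} xs (of_nat CARD('a) * t) +
    (if \<forall>v\<in>W. x \<bullet> v = 0 then t * of_nat (card W) * rank_sum \<chi> W xs t else 0)"
proof -
  note * = submodule_vecD[OF W]
  let ?q = "of_nat CARD('a) :: complex"
  let ?L = "\<lambda>W. {ys. set ys \<subseteq> W \<and> length ys = length xs}"
  let ?r = "\<lambda>ys. rank (mat_of_cols n ys)"
  let ?p = "\<lambda>ys. \<chi> (sum_list (map2 (\<bullet>) xs ys))"
  let ?perp = "\<forall>v\<in>W. x \<bullet> v = 0"
  have fin: "finite (?L W)" using finite_lists_length_eq[of W] * by simp
  have inner: "(\<Sum>v\<in>W. \<chi> (sum_list (map2 (\<bullet>) (x # xs) (v # ys))) * t ^ ?r (v # ys)) =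
      (if \<forall>v\<in>set ys. x \<bullet> v = 0 then (1 - t) * (?p ys * (?q * t) ^ ?r ys) else 0) +
      (if ?perp then t * of_nat (card W) * (?p ys * t ^ ?r ys) else 0)"
    (is "?lhs = ?rhs") if ys: "ys \<in> ?L W" for ys
  proof -
    have yc: "set ys \<subseteq> carrier_vec n" using ys * by auto
    have sub: "submodule class_ring (span (set ys)) V" using yc by (intro span_is_submodule) auto
    have sW: "span (set ys) \<subseteq> W" using ys W by (intro span_is_subset) auto
    \<comment> \<open>A new column multiplies the weight by \<open>t\<close> outside the span and by
      \<open>1 = t + (1 - t)\<close> inside it.\<close>
    have "?lhs = (\<Sum>v\<in>W. ?p ys * t ^ ?r ys * (t * \<chi> (x \<bullet> v) +
        (if v \<in> span (set ys) then (1 - t) * \<chi> (x \<bullet> v) else 0)))"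
      using \<chi> yc * by (intro sum.cong)
        (auto simp: rank_mat_of_cols_Cons nontrivial_additive_character_def additive_character_add
          algebra_simps subset_iff)
    also have "\<dots> = ?p ys * t ^ ?r ys * (t * (\<Sum>v\<in>W. \<chi> (x \<bullet> v)) +
        (1 - t) * (\<Sum>v\<in>span (set ys). \<chi> (x \<bullet> v)))"
    proof -
      have "(\<Sum>v\<in>W. if v \<in> span (set ys) then (1 - t) * \<chi> (x \<bullet> v) else 0) =
          (\<Sum>v\<in>span (set ys). (1 - t) * \<chi> (x \<bullet> v))"
        using sW *(5) by (subst sum.inter_restrict[symmetric]) (auto simp: Int_absorb1)
      then show ?thesis by (simp only: sum_distrib_left[symmetric] sum.distrib)
    qed
    also have "\<dots> = ?rhs"
      using character_sum_submodule[OF \<chi> W x] character_sum_submodule[OF \<chi> sub x]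
        card_span_eq_rank[OF yc] span_perp_iff[OF yc x]
      by (simp add: algebra_simps power_mult_distrib)
    finally show ?thesis .
  qed
  \<comment> \<open>The surviving lists \<open>ys\<close> are those with all columns orthogonal to
    \<open>x\<close>, that is, the lists over the smaller subspace.\<close>
  have restrict: "?L {v \<in> W. x \<bullet> v = 0} = {ys \<in> ?L W. \<forall>v\<in>set ys. x \<bullet> v = 0}" by auto
  have "rank_sum \<chi> W (x # xs) t = (\<Sum>ys\<in>?L W.
      (if \<forall>v\<in>set ys. x \<bullet> v = 0 then (1 - t) * (?p ys * (?q * t) ^ ?r ys) else 0) +
      (if ?perp then t * of_nat (card W) * (?p ys * t ^ ?r ys) else 0))"
    unfolding rank_sum_def length_Cons sum_lists_length_Suc[OF *(5)]
    by (rule sum.cong[OF refl], rule inner)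
  also have "\<dots> = (1 - t) * rank_sum \<chi> {v \<in> W. x \<bullet> v = 0} xs (?q * t) +
      (if ?perp then t * of_nat (card W) * rank_sum \<chi> W xs t else 0)"
  proof -
    have "(\<Sum>ys\<in>?L W. if \<forall>v\<in>set ys. x \<bullet> v = 0 then (1 - t) * (?p ys * (?q * t) ^ ?r ys) else 0) =
        (1 - t) * rank_sum \<chi> {v \<in> W. x \<bullet> v = 0} xs (?q * t)"
      unfolding rank_sum_def restrict sum.inter_filter[OF fin] sum_distrib_left
      by (intro sum.cong refl) simp
    moreover have "(\<Sum>ys\<in>?L W. if ?perp then t * of_nat (card W) * (?p ys * t ^ ?r ys) else 0) =
        (if ?perp then t * of_nat (card W) * rank_sum \<chi> W xs t else 0)"
    proof -
      have "(\<Sum>y\<in>S. if b then f y else 0) = (if b then sum f S else 0)"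
        for b and f :: "'a vec list \<Rightarrow> complex" and S by simp
      then show ?thesis unfolding rank_sum_def sum_distrib_left .
    qed
    ultimately show ?thesis by (simp only: sum.distrib)
  qed
  finally show ?thesis .
qed

text \<open>Here \<open>e\<close> is the dimension of the part of \<open>W\<close> orthogonal to all
  of \<open>xs\<close>, and \<open>s\<close> is its codimension in \<open>W\<close>. A first column
  orthogonal to \<open>W\<close> keeps \<open>W\<close> and \<open>s\<close>; any other column cuts
  \<open>W\<close> to a hyperplane and lowers \<open>s\<close> by one. The bound on \<open>s\<close>
  is proved along with the formula to keep the subtraction \<open>length xs - s\<close>
  exact.\<close>

lemma rank_sum_eq:
  assumes \<chi>: "nontrivial_additive_character \<chi>" and W: "submodule class_ring W V"
    and "set xs \<subseteq> carrier_vec n"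
    and "card W = CARD('a) ^ (e + s)"
    and "card {v \<in> W. \<forall>x\<in>set xs. x \<bullet> v = 0} = CARD('a) ^ e"
  defines "q \<equiv> of_nat CARD('a) :: complex"
  shows "s \<le> length xs \<and>
    rank_sum \<chi> W xs t = q_pochhammer t q s * q_sum q e (length xs - s) (q ^ s * t)"
  using W assms(3-5)
proof (induction xs arbitrary: W s t)
  case Nil
  \<comment> \<open>Without columns the orthogonality condition is vacuous, so the two cardinalities
    coincide.\<close>
  then have "s = 0" using card_field_gt_1 power_inject_exp[of "CARD('a)" "e + s" e] by simp
  then show ?case
    using \<chi> by (simp add: q_sum_0 nontrivial_additive_character_def)
next
  case (Cons x xs)
  have q0: "q \<noteq> 0" by (simp add: q_def)
  have q1: "q ^ Suc u \<noteq> 1" for u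
  proof -
    have "CARD('a) ^ Suc u \<noteq> 1"
      using one_less_power[OF card_field_gt_1[where ?'a = 'a], of "Suc u"]
      by (metis less_irrefl zero_less_Suc)
    then show ?thesis unfolding q_def of_nat_power[symmetric] of_nat_eq_1_iff .
  qed
  have x: "x \<in> carrier_vec n" "set xs \<subseteq> carrier_vec n" using Cons.prems by auto
  let ?H = "{v \<in> W. x \<bullet> v = 0}"
  note step = rank_sum_Cons[OF \<chi> Cons.prems(1) x(1), of xs t, folded q_def]
  have perp: "{v \<in> W. \<forall>x\<in>set (x # xs). x \<bullet> v = 0} = {v \<in> ?H. \<forall>x\<in>set xs. x \<bullet> v = 0}" by auto
  show ?case
  proof (cases "\<forall>v\<in>W. x \<bullet> v = 0")
    case True
    then have H: "?H = W" by auto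
    have "card {v \<in> W. \<forall>x\<in>set xs. x \<bullet> v = 0} = CARD('a) ^ e"
      using Cons.prems(4) unfolding perp H .
    note IH = Cons.IH[OF Cons.prems(1) x(2) Cons.prems(3) this]
    from IH have s: "s \<le> length xs" by (rule conjunct1)
    have eq: "rank_sum \<chi> W xs t = q_pochhammer t q s * q_sum q e (length xs - s) (q ^ s * t)" for t
      using IH by (rule conjunct2)
    have cW: "of_nat (card W) = q ^ (e + s)" by (simp add: Cons.prems(3) q_def)
    \<comment> \<open>Both sides are \<open>q_pochhammer t q (Suc s)\<close>. This creates the
      factor \<open>1 - q ^ s * t\<close> that \<open>q_sum_Suc\<close> needs at the argument
      \<open>q ^ s * t\<close>.\<close>
    have p: "(1 - t) * q_pochhammer (q * t) q s = (1 - q ^ s * t) * q_pochhammer t q s"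
      using q_pochhammer_Suc_left[of t q s] q_pochhammer_Suc[of t q s] by (simp add: mult.commute)
    have "rank_sum \<chi> W (x # xs) t = (1 - t) * q_pochhammer (q * t) q s * q_sum q e (length xs - s) (q * (q ^ s * t)) +
        t * q ^ (e + s) * (q_pochhammer t q s * q_sum q e (length xs - s) (q ^ s * t))"
      unfolding step H eq cW if_P[OF True] by (simp only: mult.assoc mult.left_commute[of q])
    also have "\<dots> = q_pochhammer t q s * q_sum q e (Suc (length xs - s)) (q ^ s * t)"
      unfolding p q_sum_Suc[OF q0 q1] by (simp add: algebra_simps power_add)
    finally show ?thesis using s by (simp add: Suc_diff_le)
  next
    case False
    then obtain v where v: "v \<in> W" "x \<bullet> v \<noteq> 0" by auto
    have H: "submodule class_ring ?H V" using submodule_inter_perp[OF Cons.prems(1), of "{x}"] x by simp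
    have cW: "card W = CARD('a) * card ?H" by (rule card_hyperplane[OF Cons.prems(1) x(1) v])
    \<comment> \<open>The common orthogonal part lies in the hyperplane \<open>?H\<close>, which is
      smaller than \<open>W\<close>; hence \<open>s\<close> is positive.\<close>
    have "CARD('a) ^ e \<le> card ?H"
      unfolding Cons.prems(4)[symmetric] perp using submodule_vecD(5)[OF H] by (intro card_mono) auto
    then have "CARD('a) ^ Suc e \<le> CARD('a) ^ (e + s)" using cW Cons.prems(3) by simp
    then have "Suc e \<le> e + s" using card_field_gt_1 power_increasing_iff by blast
    then obtain s' where s': "s = Suc s'" by (cases s) auto
    have "card ?H = CARD('a) ^ (e + s')" using cW Cons.prems(3) by (simp add: s')
    note IH = Cons.IH[OF H x(2) this Cons.prems(4)[unfolded perp], of "q * t"]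
    \<comment> \<open>Only the first summand of the recursion survives; \<open>1 - t\<close> is the
      first factor of the Pochhammer product, and
      \<open>q ^ s' * (q * t) = q ^ s * t\<close>.\<close>
    have "rank_sum \<chi> W (x # xs) t = (1 - t) * rank_sum \<chi> ?H xs (q * t)"
      unfolding step if_not_P[OF False] by (rule add_0_right)
    also have "\<dots> = q_pochhammer t q s * q_sum q e (length (x # xs) - s) (q ^ s * t)"
      unfolding conjunct2[OF IH] s' q_pochhammer_Suc_left power_Suc2
      by (simp only: length_Cons diff_Suc_Suc mult.assoc mult.commute[of t q])
    finally show ?thesis using conjunct1[OF IH] by (simp only: s' length_Cons Suc_le_mono)
  qed
qed

section \<open>Cardinality of orthogonal complements\<close>

lemma submodule_carrier_vec: "submodule class_ring (carrier_vec n) V"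
  unfolding submodule_vec_iff by simp

text \<open>Double counting: sum \<open>\<chi> (x \<bullet> v)\<close> over all \<open>x\<close> and all \<open>v \<in> W\<close> in both orders.\<close>
lemma card_perp:
  assumes \<chi>: "nontrivial_additive_character (\<chi> :: 'a \<Rightarrow> complex)" and W: "submodule class_ring W V"
  shows "card W * card {x \<in> carrier_vec n. \<forall>v\<in>W. x \<bullet> v = 0} = CARD('a) ^ n"
proof -
  note * = submodule_vecD[OF W]
  let ?P = "{x \<in> carrier_vec n. \<forall>v\<in>W. x \<bullet> v = 0}"
  have "of_nat (card W * card ?P) = (\<Sum>x\<in>?P. of_nat (card W) :: complex)" by simp
  also have "\<dots> = (\<Sum>x\<in>carrier_vec n. if \<forall>v\<in>W. x \<bullet> v = 0 then of_nat (card W) else 0)"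
    by (rule sum.inter_filter) simp
  also have "\<dots> = (\<Sum>x\<in>carrier_vec n. \<Sum>v\<in>W. \<chi> (x \<bullet> v))"
    by (rule sum.cong[OF refl], rule character_sum_submodule[OF \<chi> W, symmetric])
  also have "\<dots> = (\<Sum>v\<in>W. \<Sum>x\<in>carrier_vec n. \<chi> (x \<bullet> v))" by (rule sum.swap)
  also have "\<dots> = (\<Sum>v\<in>W. if v = 0\<^sub>v n then of_nat (CARD('a) ^ n) else 0)"
  proof (rule sum.cong[OF refl])
    fix v assume "v \<in> W"
    then have v: "v \<in> carrier_vec n" using *(1) by blast
    have "(\<Sum>x\<in>carrier_vec n. \<chi> (x \<bullet> v)) = (\<Sum>x\<in>carrier_vec n. \<chi> (v \<bullet> x))"
      by (rule sum.cong[OF refl]) (simp add: comm_scalar_prod[OF _ v])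
    also have "\<dots> = (if \<forall>x\<in>carrier_vec n. v \<bullet> x = 0 then of_nat (CARD('a) ^ n) else 0)"
      unfolding character_sum_submodule[OF \<chi> submodule_carrier_vec v] card_carrier_vec ..
    also have "(\<forall>x\<in>carrier_vec n. v \<bullet> x = 0) \<longleftrightarrow> v = 0\<^sub>v n"
    proof
      assume A: "\<forall>x\<in>carrier_vec n. v \<bullet> x = 0"
      show "v = 0\<^sub>v n"
      proof (rule eq_vecI)
        fix i assume "i < dim_vec (0\<^sub>v n :: 'a vec)"
        then have i: "i < n" by simp
        have "v \<bullet> unit_vec n i = 0" using A unit_vec_carrier by blast
        then show "v $ i = 0\<^sub>v n $ i" using i v by simp
      qed (use v in simp)
    qed simp
    finally show "(\<Sum>x\<in>carrier_vec n. \<chi> (x \<bullet> v)) = (if v = 0\<^sub>v n then of_nat (CARD('a) ^ n) else 0)" .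
  qed
  also have "\<dots> = of_nat (CARD('a) ^ n)" using *(2,5) by simp
  finally show ?thesis unfolding of_nat_eq_iff .
qed

lemma rank_mat_of_cols_le:
  assumes "set xs \<subseteq> carrier_vec n"
  shows "rank (mat_of_cols n xs) \<le> n"
proof -
  have "card (span (set xs)) \<le> card (carrier_vec n :: 'a vec set)"
    using submodule_vecD(1)[OF span_is_submodule[OF assms]] by (intro card_mono) simp_all
  then have "CARD('a) ^ rank (mat_of_cols n xs) \<le> CARD('a) ^ n"
    unfolding card_span_eq_rank[OF assms] card_carrier_vec .
  then show ?thesis by (rule power_le_imp_le_exp[OF card_field_gt_1])
qed

text \<open>Supplies the hypothesis of \<open>rank_sum_eq\<close> for the whole space, with
  \<open>e = n - s\<close> for columns of rank \<open>s\<close>.\<close>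

lemma card_perp_list:
  assumes \<chi>: "nontrivial_additive_character (\<chi> :: 'a \<Rightarrow> complex)" and xs: "set xs \<subseteq> carrier_vec n"
  shows "card {v \<in> carrier_vec n. \<forall>x\<in>set xs. x \<bullet> v = 0} = CARD('a) ^ (n - rank (mat_of_cols n xs))"
proof -
  let ?r = "rank (mat_of_cols n xs)"
  have "{v \<in> carrier_vec n. \<forall>x\<in>set xs. x \<bullet> v = 0} = {v \<in> carrier_vec n. \<forall>x\<in>span (set xs). v \<bullet> x = 0}"
  proof (rule Collect_cong, rule conj_cong[OF refl])
    fix v :: "'a vec" assume v: "v \<in> carrier_vec n"
    have "x \<bullet> v = v \<bullet> x" if "x \<in> set xs" for x
      using comm_scalar_prod[of x n v] that v xs by (simp add: subset_iff)
    then show "(\<forall>x\<in>set xs. x \<bullet> v = 0) \<longleftrightarrow> (\<forall>x\<in>span (set xs). v \<bullet> x = 0)"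
      unfolding span_perp_iff[OF xs v] by simp
  qed
  then have "CARD('a) ^ ?r * card {v \<in> carrier_vec n. \<forall>x\<in>set xs. x \<bullet> v = 0} = CARD('a) ^ n"
    using card_perp[OF \<chi> span_is_submodule[OF xs]] by (simp only: card_span_eq_rank[OF xs])
  also have "\<dots> = CARD('a) ^ ?r * CARD('a) ^ (n - ?r)"
    using rank_mat_of_cols_le[OF xs] by (simp add: power_add[symmetric])
  finally show ?thesis by simp
qed

section \<open>From column lists back to matrices and polynomials\<close>

text \<open>Gives the description in \<open>canonical_matrix\<close> a matrix to speak about. A zero
  column preserves the rank, a column outside the span raises it.\<close>

lemma exists_mat_of_cols_rank:
  assumes "s \<le> n" "s \<le> m"
  shows "\<exists>xs. set xs \<subseteq> carrier_vec n \<and> length xs = m \<and> rank (mat_of_cols n xs) = s"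
  using assms
proof (induction m arbitrary: s)
  case 0
  then show ?case using rank_mat_of_cols_Nil by (intro exI[of _ "[]"]) simp
next
  case (Suc m)
  show ?case
  proof (cases "s \<le> m")
    case True
    then obtain xs where xs: "set xs \<subseteq> carrier_vec n" "length xs = m" "rank (mat_of_cols n xs) = s"
      using Suc by blast
    have "rank (mat_of_cols n (0\<^sub>v n # xs)) = s"
      using rank_mat_of_cols_Cons[OF xs(1), of "0\<^sub>v n"]
        submodule_vecD(2)[OF span_is_submodule[OF xs(1)]] xs(3) by simp
    then show ?thesis using xs(1,2) by (intro exI[of _ "0\<^sub>v n # xs"]) simp
  next
    case False
    then have s: "s = Suc m" "m < n" using Suc.prems by simp_all
    then obtain xs where xs: "set xs \<subseteq> carrier_vec n" "length xs = m" "rank (mat_of_cols n xs) = m"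
      using Suc.IH[of m] by force
    \<comment> \<open>With \<open>m < n\<close> the \<open>m\<close> columns span too few vectors to
      fill the space, which leaves room for a new one.\<close>
    have "card (span (set xs)) < card (carrier_vec n :: 'a vec set)"
      unfolding card_span_eq_rank[OF xs(1)] card_carrier_vec xs(3)
      by (rule power_strict_increasing[OF s(2) card_field_gt_1])
    then have "span (set xs) \<noteq> carrier_vec n" by (metis less_irrefl)
    then obtain v where v: "v \<in> carrier_vec n" "v \<notin> span (set xs)"
      using submodule_vecD(1)[OF span_is_submodule[OF xs(1)]] by blast
    have "rank (mat_of_cols n (v # xs)) = s"
      using rank_mat_of_cols_Cons[OF xs(1) v(1)] v(2) xs(3) s(1) by simp
    then show ?thesis using xs(1,2) v(1) s(1) by (intro exI[of _ "v # xs"]) simp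
  qed
qed

text \<open>Complex polynomials that agree at every point are equal, so it suffices to evaluate at
  each \<open>t\<close>. There the left-hand side is \<open>rank_sum\<close> over the whole space,
  with the terms grouped by rank.\<close>

lemma sum_rank_character_sum:
  assumes \<theta>: "nontrivial_additive_character (\<theta> :: 'a \<Rightarrow> complex)" and A: "A \<in> carrier_mat n m"
    and s: "rank A = s"
  defines "q \<equiv> of_nat CARD('a) :: complex"
  shows "(\<Sum>r\<le>n. monom (rank_character_sum \<theta> n m A r) r) =
    q_pochhammer (monom 1 1) [:q:] s *
    (\<Sum>u\<le>n - s. monom ((-1) ^ u * q ^ ((u choose 2) + s * u)
                    * q_pochhammer (q ^ (m - s)) (inverse q) u
                    * q_binomial q (n - s) u) u)" (is "?L = ?R")
proof -
  let ?\<chi> = "\<lambda>x. cnj (\<theta> x)"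
  note \<chi> = nontrivial_additive_character_cnj[OF \<theta>]
  define xs where "xs = cols A"
  have xs: "set xs \<subseteq> carrier_vec n" "length xs = m" "A = mat_of_cols n xs"
    using A cols_dim[of A] mat_of_cols_cols[of A] by (simp_all add: xs_def)
  have fin: "finite (carrier_mat n m :: 'a mat set)"
    using bij_betw_finite[OF bij_betw_mat_of_cols] finite_lists_length_eq[OF finite_carrier_vec] by blast
  have rank_le: "rank B \<le> n" if "B \<in> carrier_mat n m" for B
    using rank_mat_of_cols_le[of "cols B"] cols_dim[of B] mat_of_cols_cols[of B] that by simp
  have "poly ?L t = poly ?R t" for t
  proof -
    have "poly ?L t = (\<Sum>r\<le>n. \<Sum>b | b \<in> carrier_mat n m \<and> rank b = r. ?\<chi> (mat_pairing A b) * t ^ rank b)"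
      by (simp add: poly_sum poly_monom rank_character_sum_def sum_distrib_right)
    also have "\<dots> = (\<Sum>b\<in>carrier_mat n m. ?\<chi> (mat_pairing A b) * t ^ rank b)"
      using rank_le by (intro sum.group[OF fin]) auto
    also have "\<dots> = rank_sum ?\<chi> (carrier_vec n) xs t"
      unfolding sum.reindex_bij_betw[OF bij_betw_mat_of_cols, symmetric] rank_sum_def xs(3)
      by (rule sum.cong) (simp_all add: xs mat_pairing_mat_of_cols[OF xs(1)])
    also have "\<dots> = q_pochhammer t q s * q_sum q (n - s) (m - s) (q ^ s * t)"
    proof -
      have "s \<le> n" using rank_le[OF A] s by simp
      then have "card (carrier_vec n :: 'a vec set) = CARD('a) ^ ((n - s) + s)"
        by (simp add: card_carrier_vec)
      moreover have "card {v \<in> carrier_vec n. \<forall>x\<in>set xs. x \<bullet> v = 0} = CARD('a) ^ (n - s)"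
        using card_perp_list[OF \<chi> xs(1)] s xs(3) by simp
      ultimately show ?thesis
        using rank_sum_eq[OF \<chi> submodule_carrier_vec xs(1)] unfolding q_def xs(2) by blast
    qed
    also have "\<dots> = poly ?R t"
    proof -
      \<comment> \<open>The exponent \<open>s * u\<close> comes from the argument
        \<open>q ^ s * t\<close> raised to the power \<open>u\<close>.\<close>
      have "q_sum q (n - s) (m - s) (q ^ s * t) = (\<Sum>u\<le>n - s. (-1) ^ u * q ^ ((u choose 2) + s * u)
          * q_pochhammer (q ^ (m - s)) (inverse q) u * q_binomial q (n - s) u * t ^ u)"
        unfolding q_sum_def
        by (intro sum.cong refl) (simp add: power_add power_mult power_mult_distrib)
      then show ?thesis by (simp add: poly_q_pochhammer poly_monom poly_sum)
    qed
    finally show ?thesis .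
  qed
  then show ?thesis unfolding poly_eq_poly_eq_iff[symmetric] by (rule ext)
qed

end

theorem proposition5p2p3:
  fixes \<theta> :: "'a::{field,finite} \<Rightarrow> complex"
    and q :: complex
    and n m s :: nat
  assumes "nontrivial_additive_character \<theta>"
    and "q = of_nat (card (UNIV :: 'a set))"
    and "s \<le> n" and "n \<le> m"
  shows "(\<Sum>r\<le>n. monom (canonical_matrix \<theta> n m s r) r) =
    q_pochhammer (monom 1 1) [:q:] s *
    (\<Sum>u\<le>n - s. monom ((-1) ^ u * q ^ ((u choose 2) + s * u)
                    * q_pochhammer (q ^ (m - s)) (inverse q) u
                    * q_binomial q (n - s) u) u)" (is "_ = ?R")
proof -
  interpret finite_vec_space "TYPE('a)" n .
  have sum_eq: "(\<Sum>r\<le>n. monom (rank_character_sum \<theta> n m A r) r) = ?R"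
    if "A \<in> carrier_mat n m" "rank A = s" for A
    using sum_rank_character_sum[OF assms(1) that] unfolding assms(2) .
  \<comment> \<open>The coefficients of \<open>?R\<close> do not mention \<open>A\<close>; hence the
    character sum is the same for all matrices of rank \<open>s\<close>.\<close>
  have entry: "rank_character_sum \<theta> n m A r = coeff ?R r"
    if A: "A \<in> carrier_mat n m" "rank A = s" and r: "r \<le> n" for A r
    using r unfolding sum_eq[OF A, symmetric] by (simp add: coeff_sum)
  \<comment> \<open>A matrix of rank \<open>s\<close> exists since \<open>s \<le> n \<le> m\<close>;
    it forces the uniqueness of the value described by \<open>canonical_matrix\<close>.\<close>
  obtain xs :: "'a vec list" where xs: "length xs = m" "rank (mat_of_cols n xs) = s"
    using exists_mat_of_cols_rank[of s m] assms(3,4) by auto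
  have A: "mat_of_cols n xs \<in> carrier_mat n m" using xs(1) by auto
  have "canonical_matrix \<theta> n m s r = rank_character_sum \<theta> n m (mat_of_cols n xs) r" if "r \<le> n" for r
    unfolding canonical_matrix_def
  proof (rule the_equality)
    show "\<forall>a\<in>carrier_mat n m. rank a = s \<longrightarrow>
        rank_character_sum \<theta> n m a r = rank_character_sum \<theta> n m (mat_of_cols n xs) r"
      using entry[OF _ _ that] A xs(2) by simp
  next
    fix c assume "\<forall>a\<in>carrier_mat n m. rank a = s \<longrightarrow> rank_character_sum \<theta> n m a r = c"
    then show "c = rank_character_sum \<theta> n m (mat_of_cols n xs) r" using A xs(2) by simp
  qed
  then have "(\<Sum>r\<le>n. monom (canonical_matrix \<theta> n m s r) r) =
      (\<Sum>r\<le>n. monom (rank_character_sum \<theta> n m (mat_of_cols n xs) r) r)" by simp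
  then show ?thesis using sum_eq[OF A xs(2)] by simp
qed

end
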